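(* For integers $N\ge k\ge 0$, $$\lim_{\lambda\to0}\lambda^{N-k}S_{2,\frac1\lambda}(N,k)=\lim_{\lambda\to0}\lambda^{N-k}B_{N,k}\big((1)_{1,\frac1\lambda},(1)_{2,\frac1\lambda},\dots,(1)_{N-k+1,\frac1\lambda}\big)=S_1(N,k),$$ where the limits are taken over nonzero real $\lambda$.
   Context: For $\mu\ne0$, $(x)_{n,\mu}=x(x-\mu)\cdots(x-(n-1)\mu)$ for $n\ge1$ and $(x)_{0,\mu}=1$. The degenerate Stirling numbers of the second kind are defined by $\frac{1}{k!}\big((1+\mu t)^{1/\mu}-1\big)^k=\sum_{n=k}^\infty S_{2,\mu}(n,k)\frac{t^n}{n!}$ (here $\mu=1/\lambda$). The exponential partial Bell polynomials are $B_{n,k}(x_1,\dots,x_{n-k+1})=\sum\frac{n!}{\prod_{l=1}^{n-k+1}i_l!}\prod_{l=1}^{n-k+1}\left(\frac{x_l}{l!}\right)^{i_l}$, the sum over nonnegative integers $i_1,\dots,i_{n-k+1}$ with $\sum_l i_l=k$ and $\sum_l l\,i_l=n$. The signed Stirling numbers of the first kind $S_1(n,k)$ are defined by $\frac{1}{k!}(\log(1+t))^k=\sum_{n\ge k}S_1(n,k)\frac{t^n}{n!}$. *)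

theory Defs
  imports "HOL-Analysis.Analysis"
begin

definition degenerate_falling :: "real \<Rightarrow> nat \<Rightarrow> real \<Rightarrow> real" where
  "degenerate_falling x n \<mu> = (\<Prod>j<n. x - real j * \<mu>)"

text \<open>
  The formal power series of \<open>(1 + \<mu> t) powr (1 / \<mu>)\<close> in \<open>t\<close>, i.e. the binomial series with
  exponent \<open>1 / \<mu>\<close> evaluated at \<open>\<mu> t\<close>. It is only meaningful for \<open>\<mu> \<noteq> 0\<close>.
\<close>
definition degenerate_exp_fps :: "real \<Rightarrow> real fps" where
  "degenerate_exp_fps \<mu> = fps_binomial (1 / \<mu>) oo (fps_const \<mu> * fps_X)"

lemma degenerate_exp_fps_sums:
  assumes "\<bar>\<mu> * t\<bar> < 1"
  shows "(\<lambda>n. fps_nth (degenerate_exp_fps \<mu>) n * t ^ n) sums ((1 + \<mu> * t) powr (1 / \<mu>))"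
proof -
  have "fps_nth (degenerate_exp_fps \<mu>) n * t ^ n = ((1 / \<mu>) gchoose n) * (\<mu> * t) ^ n" for n
    unfolding degenerate_exp_fps_def fps_compose_linear by (simp add: power_mult_distrib)
  then show ?thesis
    using gen_binomial_real[OF assms, of "1 / \<mu>"] by simp
qed

definition degenerate_stirling2 :: "real \<Rightarrow> nat \<Rightarrow> nat \<Rightarrow> real" where
  "degenerate_stirling2 \<mu> n k =
     fact n * fps_nth (fps_const (1 / fact k) * (degenerate_exp_fps \<mu> - 1) ^ k) n"

lemma degenerate_stirling2_gf:
  "fps_const (1 / fact k) * (degenerate_exp_fps \<mu> - 1) ^ k =
     Abs_fps (\<lambda>n. if n < k then 0 else degenerate_stirling2 \<mu> n k / fact n)"
proof -
  have "fps_nth ((degenerate_exp_fps \<mu> - 1) ^ k) n = 0" if "n < k" for n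
    using that by (intro startsby_zero_power_prefix[rule_format])
      (simp_all add: degenerate_exp_fps_def)
  then show ?thesis
    by (auto simp: fps_eq_iff degenerate_stirling2_def)
qed

text \<open>\<^term>\<open>fps_ln 1\<close> is the formal power series of \<open>ln (1 + t)\<close>.\<close>
definition signed_stirling1 :: "nat \<Rightarrow> nat \<Rightarrow> real" where
  "signed_stirling1 n k = fact n * fps_nth (fps_const (1 / fact k) * (fps_ln 1) ^ k) n"

lemma signed_stirling1_gf:
  "fps_const (1 / fact k) * (fps_ln 1) ^ k =
     Abs_fps (\<lambda>n. if n < k then 0 else signed_stirling1 n k / fact n)"
proof -
  have "fps_nth ((fps_ln (1 :: real)) ^ k) n = 0" if "n < k" for n
    using that by (intro startsby_zero_power_prefix[rule_format]) (simp_all add: fps_ln_nth)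
  then show ?thesis
    by (auto simp: fps_eq_iff signed_stirling1_def)
qed

text \<open>
  The index tuples \<open>(i\<^sub>1, \<dots>, i\<^sub>n\<^sub>-\<^sub>k\<^sub>+\<^sub>1)\<close> of the partial Bell polynomial, as extensional functions
  so that each tuple is counted exactly once. The difference \<open>n - k\<close> is truncated, so the intended
  range is \<open>k \<le> n\<close>.
\<close>
definition bell_indices :: "nat \<Rightarrow> nat \<Rightarrow> (nat \<Rightarrow> nat) set" where
  "bell_indices n k =
     {i \<in> {1..n - k + 1} \<rightarrow>\<^sub>E UNIV.
        (\<Sum>l = 1..n - k + 1. i l) = k \<and> (\<Sum>l = 1..n - k + 1. l * i l) = n}"

lemma finite_bell_indices: "finite (bell_indices n k)"
proof (rule finite_subset)
  show "bell_indices n k \<subseteq> {1..n - k + 1} \<rightarrow>\<^sub>E {..k}"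
  proof
    fix i assume i: "i \<in> bell_indices n k"
    have "i l \<le> k" if "l \<in> {1..n - k + 1}" for l
    proof -
      have "i l \<le> (\<Sum>l = 1..n - k + 1. i l)"
        using that by (intro member_le_sum) auto
      then show ?thesis
        using i by (simp add: bell_indices_def)
    qed
    then show "i \<in> {1..n - k + 1} \<rightarrow>\<^sub>E {..k}"
      using i by (auto simp: bell_indices_def PiE_iff)
  qed
qed (auto intro: finite_PiE)

text \<open>
  The polynomial is given by its evaluation at \<open>x\<^sub>l = x l\<close>; only the values \<open>x 1\<close>, ...,
  \<open>x (n - k + 1)\<close> are used.
\<close>
definition partial_bell :: "nat \<Rightarrow> nat \<Rightarrow> (nat \<Rightarrow> real) \<Rightarrow> real" where
  "partial_bell n k x =
     (\<Sum>i \<in> bell_indices n k.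
        fact n / (\<Prod>l = 1..n - k + 1. fact (i l)) * (\<Prod>l = 1..n - k + 1. (x l / fact l) ^ i l))"

end

theory Submission
  imports Defs
begin

text \<open>
  With \<open>\<mu> = 1 / c\<close>, the degenerate exponential is \<open>(1 + t / c) powr c\<close>, so rescaling \<open>t\<close> by \<open>c\<close>
  turns \<open>c ^ (N - k) * S\<^sub>2(N, k)\<close> into \<open>N! / k!\<close> times the coefficient of \<open>t ^ N\<close> in
  \<open>(((1 + t) powr c - 1) / c) ^ k\<close>, whose base converges coefficientwise to \<open>ln (1 + t)\<close> as
  \<open>c \<rightarrow> 0\<close>. The partial Bell polynomial is the same quantity by the multinomial theorem.
\<close>

text \<open>Induction on \<open>A\<close>: the binomial theorem splits off the power of
  \<open>a x\<close>, and the induction hypothesis expands the rest. The exponents are extensional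
  functions, as in \<open>bell_indices\<close>, so that each tuple occurs once.\<close>

lemma multinomial_fps:
  fixes a :: "'b \<Rightarrow> 'a :: field_char_0 fps"
  assumes "finite A"
  shows "(\<Sum>l\<in>A. a l) ^ k =
    (\<Sum>i | i \<in> A \<rightarrow>\<^sub>E (UNIV :: nat set) \<and> sum i A = k.
       fps_const (fact k / (\<Prod>l\<in>A. fact (i l))) * (\<Prod>l\<in>A. a l ^ i l))"
  using assms
proof (induction A arbitrary: k rule: finite_induct)
  case empty
  have "{i. i = (\<lambda>x::'b. undefined :: nat) \<and> 0 = k} = (if k = 0 then {\<lambda>x. undefined} else {})"
    by auto
  then show ?case by simp
next
  case (insert x A)
  define M where "M B m = {i. i \<in> B \<rightarrow>\<^sub>E (UNIV :: nat set) \<and> sum i B = m}" for B :: "'b set" and m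
  define c :: "'b set \<Rightarrow> nat \<Rightarrow> ('b \<Rightarrow> nat) \<Rightarrow> 'a"
    where "c B m i = fact m / (\<Prod>l\<in>B. fact (i l))" for B m i
  have fin: "finite (M A m)" for m
  proof (rule finite_subset)
    show "M A m \<subseteq> A \<rightarrow>\<^sub>E {..m}"
      using insert.hyps by (auto simp: M_def PiE_def intro!: member_le_sum)
  qed (use insert.hyps in \<open>auto intro: finite_PiE\<close>)
  \<comment> \<open>Since \<open>x\<close> is outside \<open>A\<close>, changing an exponent at
    \<open>x\<close> is invisible to sums and products over \<open>A\<close>.\<close>
  have upd: "(\<Sum>l\<in>A. if l = x then j else i l) = sum i A" for i :: "'b \<Rightarrow> nat" and j
    using insert.hyps by (intro sum.cong) auto
  have updp: "(\<Prod>l\<in>A. g l ((i(x := j)) l)) = (\<Prod>l\<in>A. g l (i l))"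
    for g :: "'b \<Rightarrow> nat \<Rightarrow> 'd :: comm_monoid_mult" and i j
    using insert.hyps by (intro prod.cong) auto
  have "(\<Sum>l\<in>insert x A. a l) ^ k = (\<Sum>j\<le>k. of_nat (k choose j) * a x ^ j * (\<Sum>l\<in>A. a l) ^ (k - j))"
    using insert.hyps by (simp add: binomial_ring)
  also have "\<dots> = (\<Sum>j\<le>k. \<Sum>i\<in>M A (k - j). of_nat (k choose j) * a x ^ j *
      (fps_const (c A (k - j) i) * (\<Prod>l\<in>A. a l ^ i l)))"
    unfolding insert.IH M_def c_def by (simp add: sum_distrib_left)
  also have "\<dots> = (\<Sum>(j, i)\<in>Sigma {..k} (\<lambda>j. M A (k - j)). of_nat (k choose j) * a x ^ j *
      (fps_const (c A (k - j) i) * (\<Prod>l\<in>A. a l ^ i l)))"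
    by (intro sum.Sigma) (auto simp: fin)
  also have "\<dots> = (\<Sum>i\<in>M (insert x A) k. fps_const (c (insert x A) k i) * (\<Prod>l\<in>insert x A. a l ^ i l))"
  \<comment> \<open>A tuple on \<open>insert x A\<close> is its value \<open>j\<close> at
    \<open>x\<close> together with a tuple on \<open>A\<close> of total \<open>k - j\<close>. The
    inverse map resets the value at \<open>x\<close> to \<open>undefined\<close>, which keeps the
    restriction extensional on \<open>A\<close>.\<close>
  proof (rule sum.reindex_bij_witness
      [where j = "\<lambda>(j, i). i(x := j)" and i = "\<lambda>i. (i x, i(x := undefined))"], goal_cases)
    case (1 p)
    then show ?case
      using insert.hyps by (auto simp: M_def PiE_iff extensional_def fun_eq_iff)
  next
    case (2 p)
    then show ?case
      using insert.hyps by (auto simp: M_def upd PiE_iff extensional_def)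
  next
    case (3 i)
    then show ?case by auto
  next
    case (4 i)
    then show ?case
      using insert.hyps by (auto simp: M_def upd PiE_iff extensional_def)
  next
    case (5 p)
    obtain j i where p: "p = (j, i)" by force
    with 5 have j: "j \<le> k" by simp
    \<comment> \<open>The factor \<open>fact (k - j)\<close> cancels against the binomial
      coefficient, leaving \<open>fact k\<close> over \<open>fact j\<close> and the factorials for
      \<open>A\<close>.\<close>
    have "c (insert x A) k (i(x := j)) = of_nat (k choose j) * c A (k - j) i"
      using insert.hyps updp[of "\<lambda>_. fact" i j]
      by (simp add: c_def binomial_fact[OF j] del: fun_upd_apply) simp
    then have "fps_const (c (insert x A) k (i(x := j))) =
        of_nat (k choose j) * fps_const (c A (k - j) i)"
      by (simp only: fps_of_nat flip: fps_const_mult)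
    moreover have "(\<Prod>l\<in>insert x A. a l ^ (i(x := j)) l) = a x ^ j * (\<Prod>l\<in>A. a l ^ i l)"
      using insert.hyps updp[of "\<lambda>l. power (a l)" i j] by (simp del: fun_upd_apply) simp
    ultimately show ?case
      by (simp only: p prod.case mult_ac)
  qed
  finally show ?case by (simp only: M_def c_def)
qed

text \<open>Cauchy products only look at lower coefficients. This lets a series be truncated to a
  polynomial before the finite multinomial theorem is applied.\<close>

lemma fps_power_nth_cong:
  fixes f g :: "'a :: comm_semiring_1 fps"
  assumes "\<And>i. i \<le> n \<Longrightarrow> fps_nth f i = fps_nth g i"
  shows "fps_nth (f ^ k) n = fps_nth (g ^ k) n"
  using assms
proof (induction k arbitrary: n)
  case (Suc k)
  have "fps_nth (f ^ k) i = fps_nth (g ^ k) i" if "i \<le> n" for i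
    using that Suc.prems by (intro Suc.IH) auto
  with Suc.prems show ?case
    by (auto simp: fps_mult_nth intro!: sum.cong)
qed simp

text \<open>Each coefficient of a power is a polynomial in finitely many coefficients of the base,
  hence continuous in them.\<close>

lemma tendsto_fps_power_nth:
  fixes f :: "'b \<Rightarrow> 'a :: {comm_semiring_1, topological_semigroup_mult, topological_comm_monoid_add} fps"
  assumes "\<And>n. ((\<lambda>x. fps_nth (f x) n) \<longlongrightarrow> fps_nth g n) F"
  shows "((\<lambda>x. fps_nth (f x ^ k) n) \<longlongrightarrow> fps_nth (g ^ k) n) F"
proof (induction k arbitrary: n)
  case (Suc k)
  then show ?case
    by (auto simp: fps_mult_nth intro!: tendsto_sum tendsto_mult assms)
qed simp

text \<open>Dividing the base by \<open>fps_X\<close> turns coefficient \<open>n\<close> into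
  coefficient \<open>n - k\<close>, which involves only \<open>x 1\<close>, ...,
  \<open>x (n - k + 1)\<close>. The truncated base is a finite sum of monomials, so
  \<open>multinomial_fps\<close> applies.\<close>

lemma partial_bell_eq_fps_nth:
  assumes "k \<le> n"
  shows "partial_bell n k x =
    fact n / fact k * fps_nth (Abs_fps (\<lambda>l. if l = 0 then 0 else x l / fact l) ^ k) n"
proof -
  define m where "m = n - k + 1"
  \<comment> \<open>\<open>G\<close> is the base divided by \<open>fps_X\<close>; \<open>H\<close>
    keeps its coefficients 0 to \<open>n - k\<close>, which are \<open>m\<close> in number.\<close>
  define G where "G = Abs_fps (\<lambda>l. x (Suc l) / fact (Suc l))"
  define H where "H = Abs_fps (\<lambda>l. if l < m then x (Suc l) / fact (Suc l) else 0)"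
  have XH: "fps_X * H = (\<Sum>l = 1..m. fps_const (x l / fact l) * fps_X ^ l)"
  proof (rule fps_ext)
    fix j show "fps_nth (fps_X * H) j = fps_nth (\<Sum>l = 1..m. fps_const (x l / fact l) * fps_X ^ l) j"
      by (cases j) (auto simp: H_def fps_sum_nth if_distrib simp del: fact_Suc cong: if_cong)
  qed
  have "Abs_fps (\<lambda>l. if l = 0 then 0 else x l / fact l) = fps_X * G"
  proof (rule fps_ext)
    fix j show "fps_nth (Abs_fps (\<lambda>l. if l = 0 then 0 else x l / fact l)) j = fps_nth (fps_X * G) j"
      by (cases j) (auto simp: G_def simp del: fact_Suc)
  qed
  then have "fps_nth (Abs_fps (\<lambda>l. if l = 0 then 0 else x l / fact l) ^ k) n = fps_nth (G ^ k) (n - k)"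
    using assms by (simp add: power_mult_distrib fps_X_power_mult_nth)
  also have "\<dots> = fps_nth (H ^ k) (n - k)"
    by (rule fps_power_nth_cong) (auto simp: G_def H_def m_def)
  also have "\<dots> = fps_nth ((fps_X * H) ^ k) n"
    using assms by (simp add: power_mult_distrib fps_X_power_mult_nth)
  also have "\<dots> = (\<Sum>i | i \<in> {1..m} \<rightarrow>\<^sub>E (UNIV :: nat set) \<and> sum i {1..m} = k.
      if n = (\<Sum>l = 1..m. l * i l)
      then fact k / (\<Prod>l = 1..m. fact (i l)) * (\<Prod>l = 1..m. (x l / fact l) ^ i l) else 0)"
  proof -
    \<comment> \<open>Each multinomial term is a single monomial of degree equal to the sum of
      \<open>l * i l\<close>, so extracting coefficient \<open>n\<close> imposes the second
      condition of \<open>bell_indices\<close>.\<close>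
    have prod: "(\<Prod>l = 1..m. (fps_const (x l / fact l) * fps_X ^ l) ^ i l) =
        fps_const (\<Prod>l = 1..m. (x l / fact l) ^ i l) * fps_X ^ (\<Sum>l = 1..m. l * i l)" for i
    proof -
      have c: "fps_const (\<Prod>l\<in>B. h l) = (\<Prod>l\<in>B. fps_const (h l))"
        for h :: "nat \<Rightarrow> real" and B
        by (induction B rule: infinite_finite_induct) (simp_all flip: fps_const_mult)
      show ?thesis
        by (simp only: c power_sum power_mult_distrib prod.distrib fps_const_power power_mult)
    qed
    show ?thesis
      unfolding XH multinomial_fps[OF finite_atLeastAtMost] prod
      by (auto simp: fps_sum_nth fps_X_power_nth intro!: sum.cong)
  qed
  also have "\<dots> = (\<Sum>i\<in>bell_indices n k.
      fact k / (\<Prod>l = 1..m. fact (i l)) * (\<Prod>l = 1..m. (x l / fact l) ^ i l))"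
  proof (rule sum.mono_neutral_cong_right)
    show "finite {i. i \<in> {1..m} \<rightarrow>\<^sub>E (UNIV :: nat set) \<and> sum i {1..m} = k}"
    proof (rule finite_subset)
      show "{i. i \<in> {1..m} \<rightarrow>\<^sub>E (UNIV :: nat set) \<and> sum i {1..m} = k} \<subseteq> {1..m} \<rightarrow>\<^sub>E {..k}"
        by (auto simp: PiE_def intro!: member_le_sum)
    qed (auto intro: finite_PiE)
  qed (auto simp: bell_indices_def m_def)
  finally show ?thesis
    by (simp add: partial_bell_def m_def sum_distrib_left)
qed

lemma degenerate_exp_fps_nth:
  "fps_nth (degenerate_exp_fps \<mu>) n = ((1 / \<mu>) gchoose n) * \<mu> ^ n"
  unfolding degenerate_exp_fps_def fps_compose_linear by simp

lemma degenerate_falling_1: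
  assumes "\<mu> \<noteq> 0"
  shows "degenerate_falling 1 n \<mu> / fact n = fps_nth (degenerate_exp_fps \<mu>) n"
proof -
  \<comment> \<open>Pulling \<mu> out of every factor exposes the numerator of a generalized
    binomial coefficient at \<open>1 / \<mu>\<close>.\<close>
  have "degenerate_falling 1 n \<mu> = (\<Prod>j<n. (1 / \<mu> - of_nat j) * \<mu>)"
    unfolding degenerate_falling_def using assms by (intro prod.cong) (auto simp: field_simps)
  then show ?thesis
    by (simp add: degenerate_exp_fps_nth gbinomial_prod_rev prod.distrib atLeast0LessThan)
qed

lemma degenerate_stirling2_eq_partial_bell:
  assumes "k \<le> n" "\<mu> \<noteq> 0"
  shows "degenerate_stirling2 \<mu> n k = partial_bell n k (\<lambda>l. degenerate_falling 1 l \<mu>)"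
proof -
  have "degenerate_exp_fps \<mu> - 1 =
      Abs_fps (\<lambda>l. if l = 0 then 0 else degenerate_falling 1 l \<mu> / fact l)"
    by (rule fps_ext) (simp add: degenerate_falling_1[OF assms(2)] degenerate_exp_fps_nth)
  then show ?thesis
    by (simp add: partial_bell_eq_fps_nth[OF assms(1)] degenerate_stirling2_def)
qed

text \<open>Substituting \<open>t / c\<close> for \<open>t\<close> multiplies coefficient
  \<open>n\<close> by \<open>(1 / c) ^ n\<close>. Against \<open>c ^ (n - k)\<close> this leaves
  \<open>(1 / c) ^ k\<close>, one factor for each of the \<open>k\<close> copies of the
  base.\<close>

lemma degenerate_stirling2_rescale:
  assumes "k \<le> n" "c \<noteq> 0"
  shows "c ^ (n - k) * degenerate_stirling2 (1 / c) n k =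
    fact n / fact k * fps_nth ((fps_const (1 / c) * (fps_binomial c - 1)) ^ k) n"
proof -
  have eq: "degenerate_exp_fps (1 / c) - 1 = (fps_binomial c - 1) oo (fps_const (1 / c) * fps_X)"
    by (simp add: degenerate_exp_fps_def fps_compose_sub_distrib)
  have "fps_nth ((degenerate_exp_fps (1 / c) - 1) ^ k) n = (1 / c) ^ n * fps_nth ((fps_binomial c - 1) ^ k) n"
    unfolding eq by (subst fps_compose_power) (simp_all add: fps_compose_linear del: fps_compose_sub_distrib)
  moreover have "c ^ (n - k) * (1 / c) ^ n = (1 / c) ^ k"
    using assms by (simp add: power_diff power_one_over)
  ultimately show ?thesis
    by (simp add: degenerate_stirling2_def power_mult_distrib fps_const_power mult_ac)
qed

text \<open>Absorption cancels the singular \<open>1 / c\<close>: what remains is a polynomial in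
  \<open>c\<close>, so its limit is its value at 0, given by the binomial coefficient of -1.\<close>

lemma tendsto_gbinomial_over:
  "((\<lambda>c::real. (c gchoose Suc n) / c) \<longlongrightarrow> (- 1) ^ n / real (Suc n)) (at 0)"
proof -
  have "((\<lambda>c::real. ((c - 1) gchoose n) / real (Suc n)) \<longlongrightarrow> ((0 - 1) gchoose n) / real (Suc n)) (at 0)"
    unfolding gbinomial_prod_rev by (intro tendsto_intros) auto
  moreover have "((0 - 1 :: real) gchoose n) = (- 1) ^ n"
    using gbinomial_minus[of "1::real" n] by (simp add: binomial_gbinomial[symmetric])
  moreover have "\<forall>\<^sub>F c :: real in at 0. ((c - 1) gchoose n) / real (Suc n) = (c gchoose Suc n) / c"
    unfolding eventually_at_filter
    using gbinomial_absorption[where 'a = real, of n] by (auto simp: divide_simps ac_simps)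
  ultimately show ?thesis
    by (simp add: filterlim_cong)
qed

theorem theorem3p5:
  fixes N k :: nat
  assumes "k \<le> N"
  shows "((\<lambda>c::real. c ^ (N - k) * degenerate_stirling2 (1 / c) N k)
            \<longlongrightarrow> signed_stirling1 N k) (at 0) \<and>
         ((\<lambda>c::real. c ^ (N - k) * partial_bell N k (\<lambda>l. degenerate_falling 1 l (1 / c)))
            \<longlongrightarrow> signed_stirling1 N k) (at 0)"
proof -
  \<comment> \<open>Both constant coefficients vanish; the higher ones are the limits of
    \<open>tendsto_gbinomial_over\<close>.\<close>
  have coeff: "((\<lambda>c::real. fps_nth (fps_const (1 / c) * (fps_binomial c - 1)) n) \<longlongrightarrow> fps_nth (fps_ln 1) n) (at 0)" for n
  proof (cases n)
    case (Suc m)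
    then show ?thesis
      using tendsto_gbinomial_over[of m] by (simp add: fps_ln_nth)
  qed simp
  have "((\<lambda>c::real. fact N / fact k * fps_nth ((fps_const (1 / c) * (fps_binomial c - 1)) ^ k) N)
      \<longlongrightarrow> signed_stirling1 N k) (at 0)"
    using tendsto_mult_left[OF tendsto_fps_power_nth[OF coeff], of "fact N / fact k" k N]
    by (simp add: signed_stirling1_def)
  \<comment> \<open>The rescaling identity needs a nonzero \<open>c\<close>, which the punctured
    filter \<open>at 0\<close> provides.\<close>
  moreover have "\<forall>\<^sub>F c :: real in at 0.
      fact N / fact k * fps_nth ((fps_const (1 / c) * (fps_binomial c - 1)) ^ k) N =
      c ^ (N - k) * degenerate_stirling2 (1 / c) N k"
    by (auto simp: eventually_at_filter degenerate_stirling2_rescale[OF assms])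
  ultimately have lim: "((\<lambda>c::real. c ^ (N - k) * degenerate_stirling2 (1 / c) N k)
      \<longlongrightarrow> signed_stirling1 N k) (at 0)"
    by (rule Lim_transform_eventually)
  have "\<forall>\<^sub>F c :: real in at 0. c ^ (N - k) * degenerate_stirling2 (1 / c) N k =
      c ^ (N - k) * partial_bell N k (\<lambda>l. degenerate_falling 1 l (1 / c))"
    by (auto simp: eventually_at_filter degenerate_stirling2_eq_partial_bell[OF assms])
  then show ?thesis
    by (intro conjI lim Lim_transform_eventually[OF lim])
qed

end
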